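(* Let $\eta$ and $\beta$ be nonzero (real or complex) constants, and let $\alpha$ be a (real or complex) constant with $\alpha\neq-1$ and $\alpha\ne-\beta-1$. Then $$\int x^\alpha \cos(\eta x^\beta)\,dx=\frac{x^{\alpha+1}}{(\alpha+1)(\alpha+\beta+1)}\Bigl[\cos(\eta x^\beta)\;{}_1F_2\Bigl(1; \frac{\alpha+\beta+1}{2\beta}, \frac{\alpha+2\beta+1}{2\beta}; -\frac{\eta^2 x^{2\beta}}{4}\Bigr)+ \beta\eta x^{\beta}\sin(\eta x^\beta)\;{}_1F_2\Bigl(1; \frac{\alpha+2\beta+1}{2\beta}, \frac{\alpha+3\beta+1}{2\beta}; -\frac{\eta^2 x^{2\beta}}{4}\Bigr)\Bigr]+C,$$ where $C$ is an arbitrary constant of integration.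
   Context: The hypergeometric function ${}_1F_2$ is ${}_1F_2(a;b,c;x)=\sum_{n=0}^{\infty}\frac{(a)_n}{(b)_n(c)_n}\frac{x^n}{n!}$, where $(\vartheta)_n=\Gamma(\vartheta+n)/\Gamma(\vartheta)$, $(\vartheta)_0=1$ (Pochhammer symbol). The integral is an indefinite integral (antiderivative) with respect to $x$.
   Formalization: As printed the formula fails (α=0, β=η=1: derivative tends to 1/2, not 1, at 0); the cosine term is given the missing factor α+β+1. Lower parameters of 1F2 are assumed not non-positive integers; powers are principal and x avoids 0 (for complex x, the non-positive real axis). *)

theory Defs
  imports "HOL-Analysis.Analysis"
begin

text \<open>
  The series converges for every \<open>x\<close> when neither \<open>b\<close> nor \<open>c\<close> is a non-positive integer.
  Otherwise it is undefined mathematically, whereas \<open>suminf\<close> and division by zero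
  still return a (meaningless) value.
\<close>
definition hypergeom_1F2 :: "complex \<Rightarrow> complex \<Rightarrow> complex \<Rightarrow> complex \<Rightarrow> complex" where
  "hypergeom_1F2 a b c x =
     (\<Sum>n. pochhammer a n / (pochhammer b n * pochhammer c n) * (x ^ n / fact n))"

lemma hypergeom_1F2_eq_fps_hypergeo:
  "hypergeom_1F2 a b c x = eval_fps (fps_hypergeo [a] [b, c] 1) x"
  by (simp add: hypergeom_1F2_def eval_fps_def)

text \<open>
  Correction to the published formula for the integral of \<open>x\<^sup>\<alpha> cos (\<eta> x\<^sup>\<beta>)\<close>: the cosine term
  inside the bracket needs the factor \<open>\<alpha> + \<beta> + 1\<close>, so that it contributes
  \<open>x powr (\<alpha> + 1) / (\<alpha> + 1) * cos (\<eta> * x powr \<beta>) * hypergeom_1F2 ...\<close>. The published version omits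
  this factor and is false: for \<open>\<alpha> = 0\<close>, \<open>\<beta> = \<eta> = 1\<close> its derivative tends to \<open>1 / 2\<close> at \<open>0\<close>,
  but \<open>cos 0 = 1\<close>.

  Powers \<open>x powr a\<close> use the principal logarithm. On the real line this is smooth away from \<open>0\<close>,
  negative \<open>x\<close> included, and agrees with ordinary powers for integer exponents; as a function of
  a complex variable it requires removing the cut along the non-positive reals.
\<close>

end

theory Submission
  imports Defs
begin

text \<open>
  With \<open>c = (\<alpha> + 1) / \<beta> + 1\<close> and \<open>w = \<eta> x\<^sup>\<beta>\<close>, the duplication formula for Pochhammer symbols shows
  that the first \<open>1F2\<close> series is the even part of \<open>E (\<i> w)\<close>, and \<open>\<i> w / c\<close> times the second its odd
  part, where \<open>E = 1F1 (1; c; -)\<close> solves \<open>z E' = z E + (c - 1) (1 - E)\<close>. Hence the bracket, divided by \<open>\<alpha> + \<beta> + 1\<close>, is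
  \<open>P w = (exp (- \<i> w) E (\<i> w) + exp (\<i> w) E (- \<i> w)) / 2\<close>, and the exponential factors turn the
  equation for \<open>E\<close> into \<open>w P' + (c - 1) P = (c - 1) cos w\<close>. Since \<open>c - 1 = (\<alpha> + 1) / \<beta>\<close>, this says
  that \<open>x\<^sup>\<alpha>\<^sup>+\<^sup>1 P w / (\<alpha> + 1)\<close> has derivative \<open>x\<^sup>\<alpha> cos w\<close>. The substitution \<open>x = exp t\<close> treats the
  real line, including negative \<open>x\<close>, and the slit plane alike: only the derivative of the principal
  logarithm differs.
\<close>

section \<open>The series 1F1(1; c; z) and its differential equation\<close>

lemma fps_hypergeo_1F1_nth: "fps_nth (fps_hypergeo [1] [c] 1) n = 1 / pochhammer c n"
  for c :: "'a::field_char_0"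
  by (simp add: pochhammer_fact[symmetric])

text \<open>Each coefficient is \<open>c + n\<close> times its successor, and the norm of this ratio
  tends to infinity; the hypothesis on \<open>c\<close> keeps the denominators nonzero.\<close>

lemma fps_conv_radius_1F1:
  fixes c :: complex
  assumes "c \<notin> \<int>\<^sub>\<le>\<^sub>0"
  shows "fps_conv_radius (fps_hypergeo [1] [c] 1) = \<infinity>"
proof -
  have nz: "pochhammer c n \<noteq> 0" for n
    using assms pochhammer_eq_0_imp_nonpos_Int by blast
  have "filterlim (\<lambda>n. norm (c + of_nat n)) at_top sequentially"
    by (rule filterlim_at_infinity_imp_norm_at_top
        [OF tendsto_add_filterlim_at_infinity[OF tendsto_const tendsto_of_nat]])
  then have "(\<lambda>n. ereal (norm (c + of_nat n))) \<longlonglongrightarrow> \<infinity>"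
    by (simp add: tendsto_PInfty_eq_at_top)
  moreover have "norm (fps_nth (fps_hypergeo [1] [c] 1) n) / norm (fps_nth (fps_hypergeo [1] [c] 1) (Suc n))
      = norm (c + of_nat n)" for n
    unfolding fps_hypergeo_1F1_nth using nz[of n] nz[of "Suc n"]
    by (simp add: pochhammer_rec' norm_mult norm_divide)
  ultimately show ?thesis
    unfolding fps_conv_radius_def by (intro conv_radius_ratio_limit_ereal_nonzero) simp_all
qed

text \<open>Compare coefficients: in degree 0 both sides vanish because \<open>G\<close> starts with
  1, and degree \<open>Suc m\<close> is the recurrence
  \<open>pochhammer c (Suc m) = (c + m) * pochhammer c m\<close>.\<close>

lemma fps_1F1_ODE:
  fixes c :: complex
  assumes "c \<notin> \<int>\<^sub>\<le>\<^sub>0"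
  defines "G \<equiv> fps_hypergeo [1] [c] 1"
  shows "fps_X * fps_deriv G = fps_X * G + fps_const (c - 1) * (1 - G)"
proof (rule fps_ext)
  fix n
  have nz: "pochhammer c n \<noteq> 0" for n
    using assms pochhammer_eq_0_imp_nonpos_Int by blast
  show "fps_nth (fps_X * fps_deriv G) n = fps_nth (fps_X * G + fps_const (c - 1) * (1 - G)) n"
  proof (cases n)
    case (Suc m)
    have "c + of_nat m \<noteq> 0"
      using nz[of "Suc m"] by (auto simp: pochhammer_rec')
    then have "1 / pochhammer c m = (c + of_nat m) / pochhammer c (Suc m)"
      by (simp add: pochhammer_rec')
    then have "(1 + of_nat m) / pochhammer c (Suc m) =
        1 / pochhammer c m - (c - 1) / pochhammer c (Suc m)"
      by (simp only: diff_divide_distrib[symmetric]) simp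
    then show ?thesis
      unfolding G_def Suc by (simp del: fps_hypergeo_nth add: fps_hypergeo_1F1_nth)
  qed (simp add: G_def)
qed

text \<open>The formal equation passes to values because every series in it converges everywhere; it
  is then divided by \<open>z\<close>.\<close>

lemma has_field_derivative_eval_fps_1F1:
  fixes c z :: complex
  assumes "c \<notin> \<int>\<^sub>\<le>\<^sub>0" and "z \<noteq> 0"
  defines "E \<equiv> eval_fps (fps_hypergeo [1] [c] 1)"
  shows "(E has_field_derivative E z + (c - 1) * (1 - E z) / z) (at z within A)"
proof -
  let ?G = "fps_hypergeo [1] [c] 1 :: complex fps"
  have R: "fps_conv_radius ?G = \<infinity>"
    using assms(1) by (rule fps_conv_radius_1F1)
  have R': "fps_conv_radius (fps_deriv ?G) = \<infinity>"
    using fps_conv_radius_deriv[of ?G] by (simp add: R)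
  have R1: "fps_conv_radius (1 - ?G) = \<infinity>"
    using fps_conv_radius_diff[of 1 ?G] by (simp add: R)
  have R2: "fps_conv_radius (fps_X * ?G) = \<infinity>"
    using fps_conv_radius_mult[of fps_X ?G] by (simp add: R)
  have R3: "fps_conv_radius (fps_const (c - 1) * (1 - ?G)) = \<infinity>"
    using fps_conv_radius_mult[of "fps_const (c - 1)" "1 - ?G"] by (simp add: R1)
  have "z * eval_fps (fps_deriv ?G) z = eval_fps (fps_X * fps_deriv ?G) z"
    by (subst eval_fps_mult) (simp_all add: R')
  also have "\<dots> = z * E z + (c - 1) * (1 - E z)"
    unfolding fps_1F1_ODE[OF assms(1)] E_def
    by (simp add: eval_fps_add eval_fps_mult eval_fps_diff R R1 R2 R3)
  finally have "eval_fps (fps_deriv ?G) z = E z + (c - 1) * (1 - E z) / z"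
    using assms(2) by (simp add: field_simps)
  with has_field_derivative_eval_fps[of z ?G A] show ?thesis
    by (simp add: R E_def)
qed

section \<open>Even and odd parts of 1F1 as 1F2 series\<close>

lemma pochhammer_even:
  fixes c :: complex
  shows "pochhammer c (2 * n) = 4 ^ n * pochhammer (c / 2) n * pochhammer ((c + 1) / 2) n"
  using pochhammer_double[of "c / 2" n] by (simp add: power_mult add_divide_distrib)

text \<open>Splitting off the first factor \<open>c\<close> leaves a symbol of even length at
  \<open>c + 1\<close>.\<close>

lemma pochhammer_odd:
  fixes c :: complex
  shows "pochhammer c (2 * n + 1) =
    c * 4 ^ n * pochhammer ((c + 1) / 2) n * pochhammer ((c + 2) / 2) n"
  using pochhammer_even[of "c + 1" n] by (simp add: pochhammer_rec add.assoc)

text \<open>Odd powers cancel in the average; in degree \<open>2 * n\<close> the duplication formula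
  produces both lower parameters, and the upper parameter 1 cancels \<open>fact n\<close>.\<close>

lemma hypergeom_1F2_eq_even_part_1F1:
  fixes c w :: complex
  assumes "c \<notin> \<int>\<^sub>\<le>\<^sub>0"
  defines "E \<equiv> eval_fps (fps_hypergeo [1] [c] 1)"
  shows "hypergeom_1F2 1 (c / 2) ((c + 1) / 2) (- (w\<^sup>2 / 4)) = (E (\<i> * w) + E (- (\<i> * w))) / 2"
proof -
  have E: "(\<lambda>n. 1 / pochhammer c n * z ^ n) sums E z" for z
    unfolding E_def fps_hypergeo_1F1_nth[symmetric]
    by (rule sums_eval_fps) (simp add: fps_conv_radius_1F1 assms(1))
  let ?g = "\<lambda>n. (1 / pochhammer c n * (\<i> * w) ^ n + 1 / pochhammer c n * (- (\<i> * w)) ^ n) / 2"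
  have "?g sums ((E (\<i> * w) + E (- (\<i> * w))) / 2)"
    by (intro sums_divide sums_add E)
  moreover have "?g n = 0" if "n \<notin> range (\<lambda>n. 2 * n)" for n
    using that by (cases "even n") (auto elim: evenE)
  ultimately have "(\<lambda>n. ?g (2 * n)) sums ((E (\<i> * w) + E (- (\<i> * w))) / 2)"
    by (subst sums_mono_reindex[of "\<lambda>n. 2 * n"]) (simp_all add: strict_mono_def)
  moreover have "?g (2 * n) = pochhammer 1 n / (pochhammer (c / 2) n * pochhammer ((c + 1) / 2) n)
      * ((- (w\<^sup>2 / 4)) ^ n / fact n)" for n
  proof -
    \<comment> \<open>The factor 4 is displayed so that the \<open>n\<close>-th power releases the
      \<open>4 ^ n\<close> that cancels the one in \<open>pochhammer_even\<close>.\<close>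
    have sq: "(\<i> * w)\<^sup>2 = - (w\<^sup>2 / 4) * 4"
      by (simp add: power_mult_distrib)
    have "(- (w\<^sup>2 / 4)) ^ n * 4 ^ n = (\<i> * w) ^ (2 * n)"
      by (simp only: power_mult sq) (simp only: power_mult_distrib)
    note pow = this[symmetric]
    have "?g (2 * n) = (\<i> * w) ^ (2 * n) / pochhammer c (2 * n)"
      by simp
    then show ?thesis
      unfolding pow pochhammer_even by (simp add: pochhammer_fact[symmetric])
  qed
  ultimately show ?thesis
    unfolding hypergeom_1F2_def by (simp add: sums_iff)
qed

text \<open>The prefactor \<open>w / c\<close> collects the spare \<open>w\<close> of the odd power
  and the leading \<open>c\<close> in \<open>pochhammer_odd\<close>.\<close>

lemma hypergeom_1F2_eq_odd_part_1F1:
  fixes c w :: complex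
  assumes "c \<notin> \<int>\<^sub>\<le>\<^sub>0"
  defines "E \<equiv> eval_fps (fps_hypergeo [1] [c] 1)"
  shows "w / c * hypergeom_1F2 1 ((c + 1) / 2) ((c + 2) / 2) (- (w\<^sup>2 / 4)) =
    (E (\<i> * w) - E (- (\<i> * w))) / (2 * \<i>)"
proof (cases "w = 0")
  case False
  have E: "(\<lambda>n. 1 / pochhammer c n * z ^ n) sums E z" for z
    unfolding E_def fps_hypergeo_1F1_nth[symmetric]
    by (rule sums_eval_fps) (simp add: fps_conv_radius_1F1 assms(1))
  have c: "c \<noteq> 0"
    using assms(1) by auto
  let ?g = "\<lambda>n. (1 / pochhammer c n * (\<i> * w) ^ n - 1 / pochhammer c n * (- (\<i> * w)) ^ n) / (2 * \<i>)"
  have "?g sums ((E (\<i> * w) - E (- (\<i> * w))) / (2 * \<i>))"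
    by (intro sums_divide sums_diff E)
  moreover have "?g n = 0" if "n \<notin> range (\<lambda>n. 2 * n + 1)" for n
    using that by (cases "odd n") (auto elim: oddE)
  ultimately have "(\<lambda>n. ?g (2 * n + 1)) sums ((E (\<i> * w) - E (- (\<i> * w))) / (2 * \<i>))"
    by (subst sums_mono_reindex[of "\<lambda>n. 2 * n + 1"]) (simp_all add: strict_mono_def)
  \<comment> \<open>Dividing termwise by \<open>w / c\<close> isolates the 1F2 series; hence the
    separate case \<open>w = 0\<close>.\<close>
  then have "(\<lambda>n. ?g (2 * n + 1) / (w / c)) sums ((E (\<i> * w) - E (- (\<i> * w))) / (2 * \<i>) / (w / c))"
    by (rule sums_divide)
  moreover have "?g (2 * n + 1) / (w / c) =
      pochhammer 1 n / (pochhammer ((c + 1) / 2) n * pochhammer ((c + 2) / 2) n)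
      * ((- (w\<^sup>2 / 4)) ^ n / fact n)" for n
  proof -
    have sq: "(\<i> * w)\<^sup>2 = - (w\<^sup>2 / 4) * 4"
      by (simp add: power_mult_distrib)
    have "(- (w\<^sup>2 / 4)) ^ n * 4 ^ n * (\<i> * w) = (\<i> * w) ^ (2 * n + 1)"
      by (simp only: power_add power_mult sq power_one_right) (simp only: power_mult_distrib)
    note pow = this[symmetric]
    have g: "?g (2 * n + 1) = (\<i> * w) ^ (2 * n + 1) / pochhammer c (2 * n + 1) / \<i>"
      by (simp flip: mult.assoc)
    have cancel: "X * 4 ^ n * (\<i> * w) / (c * 4 ^ n * p * q) / \<i> / (w / c) = X / (p * q)" for X p q
      using c False by (simp add: mult.left_commute)
    show ?thesis
      unfolding g unfolding pow pochhammer_odd cancel by (simp add: pochhammer_fact[symmetric])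
  qed
  ultimately show ?thesis
    using c False unfolding hypergeom_1F2_def by (simp add: sums_iff)
qed simp

section \<open>The logarithm on the real line and the derivative of the bracket\<close>

text \<open>Negative reals lie on the branch cut, but along the real line the imaginary part of
  \<open>Ln\<close> is locally constant away from 0.\<close>

lemma has_vector_derivative_Ln_of_real:
  fixes x :: real
  assumes "x \<noteq> 0"
  shows "((\<lambda>x. Ln (of_real x)) has_vector_derivative 1 / of_real x) (at x)"
proof (rule has_vector_derivative_transform_within_open)
  \<comment> \<open>For \<open>y\<close> with the sign of \<open>x\<close>, \<open>sgn x * y\<close>
    is the absolute value of \<open>y\<close>, and the constant is \<open>\<i>\<close> times its
    argument.\<close>
  let ?L = "\<lambda>y. of_real (ln (sgn x * y)) + (if x < 0 then pi else 0) * \<i>"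
  show "(?L has_vector_derivative 1 / of_real x) (at x)"
    using assms by (auto intro!: derivative_eq_intros simp: sgn_if field_simps)
  show "open {y. 0 < x * y}"
    by (intro open_Collect_less continuous_intros)
  show "x \<in> {y. 0 < x * y}"
    using assms by (auto simp: zero_less_mult_iff)
  show "?L y = Ln (of_real y)" if "y \<in> {y. 0 < x * y}" for y
    using that by (subst Ln_of_real') (auto simp: zero_less_mult_iff sgn_if)
qed

text \<open>By Euler's formulas the coefficient of \<open>E (\<i> * w)\<close> is
  \<open>(cos w - \<i> * sin w) / 2\<close>, and that of \<open>E (- (\<i> * w))\<close> has the
  opposite sign of \<open>\<i>\<close>.\<close>

lemma cos_sin_hypergeom_1F2_eq_1F1:
  fixes c w :: complex
  assumes "c \<notin> \<int>\<^sub>\<le>\<^sub>0"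
  defines "E \<equiv> eval_fps (fps_hypergeo [1] [c] 1)"
  shows "cos w * hypergeom_1F2 1 (c / 2) ((c + 1) / 2) (- (w\<^sup>2 / 4)) +
      sin w * (w / c * hypergeom_1F2 1 ((c + 1) / 2) ((c + 2) / 2) (- (w\<^sup>2 / 4))) =
    (exp (- (\<i> * w)) * E (\<i> * w) + exp (\<i> * w) * E (- (\<i> * w))) / 2"
  unfolding hypergeom_1F2_eq_even_part_1F1[OF assms(1)] hypergeom_1F2_eq_odd_part_1F1[OF assms(1)]
    E_def[symmetric] cos_exp_eq sin_exp_eq'
  by (simp add: field_simps)

text \<open>Differentiating each exponential factor cancels the term \<open>E z\<close> in the
  equation for \<open>E\<close>; the inhomogeneous terms then average to
  \<open>cos w\<close>.\<close>

lemma has_field_derivative_cos_sin_hypergeom_1F2: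
  fixes c w :: complex
  assumes "c \<notin> \<int>\<^sub>\<le>\<^sub>0" and "w \<noteq> 0"
  defines "P \<equiv> \<lambda>w. cos w * hypergeom_1F2 1 (c / 2) ((c + 1) / 2) (- (w\<^sup>2 / 4)) +
      sin w * (w / c * hypergeom_1F2 1 ((c + 1) / 2) ((c + 2) / 2) (- (w\<^sup>2 / 4)))"
  shows "(P has_field_derivative (c - 1) * (cos w - P w) / w) (at w)"
proof -
  define E where "E = eval_fps (fps_hypergeo [1] [c] (1 :: complex))"
  have P: "P = (\<lambda>w. (exp (- (\<i> * w)) * E (\<i> * w) + exp (\<i> * w) * E (- (\<i> * w))) / 2)"
    unfolding P_def cos_sin_hypergeom_1F2_eq_1F1[OF assms(1)] E_def ..
  have E: "(E has_field_derivative E z + (c - 1) * (1 - E z) / z) (at z within A)"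
    if "z \<noteq> 0" for z A
    unfolding E_def using assms(1) that by (rule has_field_derivative_eval_fps_1F1)
  show ?thesis
    unfolding P cos_exp_eq
    using assms(2)
    by (auto intro!: derivative_eq_intros DERIV_chain2[OF E] simp: field_simps)
qed

text \<open>For \<open>w = \<eta> * exp (\<beta> * t)\<close>, d/dt is \<open>\<beta>\<close> times
  w d/dw, so \<open>P\<close> satisfies a linear equation in \<open>t\<close> for which the
  exponential is an integrating factor.\<close>

lemma has_field_derivative_power_cos_antiderivative:
  fixes \<alpha> \<beta> \<eta> t :: complex
  assumes "\<eta> \<noteq> 0" and "\<beta> \<noteq> 0" and "\<alpha> \<noteq> - 1"
  defines "c \<equiv> (\<alpha> + 1) / \<beta> + 1"
  assumes "c \<notin> \<int>\<^sub>\<le>\<^sub>0"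
  defines "P \<equiv> \<lambda>w. cos w * hypergeom_1F2 1 (c / 2) ((c + 1) / 2) (- (w\<^sup>2 / 4)) +
      sin w * (w / c * hypergeom_1F2 1 ((c + 1) / 2) ((c + 2) / 2) (- (w\<^sup>2 / 4)))"
  shows "((\<lambda>t. exp ((\<alpha> + 1) * t) / (\<alpha> + 1) * P (\<eta> * exp (\<beta> * t))) has_field_derivative
    exp ((\<alpha> + 1) * t) * cos (\<eta> * exp (\<beta> * t))) (at t)"
proof -
  have P: "(P has_field_derivative (c - 1) * (cos w - P w) / w) (at w)" if "w \<noteq> 0" for w
    unfolding P_def using assms(5) that by (rule has_field_derivative_cos_sin_hypergeom_1F2)
  have "\<alpha> + 1 \<noteq> 0"
    using assms(3) by (simp add: eq_neg_iff_add_eq_0)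
  let ?w = "\<eta> * exp (\<beta> * t)"
  have "((\<lambda>t. P (\<eta> * exp (\<beta> * t))) has_field_derivative
      (c - 1) * (cos ?w - P ?w) / ?w * (?w * \<beta>)) (at t)"
    using assms(1) by (intro DERIV_chain2[OF P]) (auto intro!: derivative_eq_intros)
  moreover have "(c - 1) * (cos ?w - P ?w) / ?w * (?w * \<beta>) = (\<alpha> + 1) * (cos ?w - P ?w)"
    using assms(1,2) by (simp add: c_def)
  ultimately have w: "((\<lambda>t. P (\<eta> * exp (\<beta> * t))) has_field_derivative
      (\<alpha> + 1) * (cos ?w - P ?w)) (at t)"
    by simp
  have e: "((\<lambda>t. exp ((\<alpha> + 1) * t) / (\<alpha> + 1)) has_field_derivative exp ((\<alpha> + 1) * t)) (at t)"
    using \<open>\<alpha> + 1 \<noteq> 0\<close> by (auto intro!: derivative_eq_intros)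
  \<comment> \<open>The product rule with \<open>E\<close> the exponential,
    \<open>a = \<alpha> + 1\<close>, \<open>X = P w\<close> and \<open>C = cos w\<close>: the terms
    in \<open>X\<close> cancel.\<close>
  have "E * X + a * (C - X) * (E / a) = E * C" if "a \<noteq> 0" for E X C a :: complex
    using that by (simp add: field_simps)
  then show ?thesis
    using \<open>\<alpha> + 1 \<noteq> 0\<close> by (intro DERIV_cong[OF DERIV_mult[OF e w]])
qed

section \<open>Antiderivatives are determined up to a constant\<close>

text \<open>A connected set of reals is convex, so a difference with derivative 0 is constant;
  openness lets the converse transfer the derivative.\<close>

lemma has_vector_derivative_iff_eq_plus_const:
  fixes f :: "real \<Rightarrow> 'a::real_normed_vector"
  assumes "open I" and "connected I"
    and F: "\<And>x. x \<in> I \<Longrightarrow> (F has_vector_derivative f x) (at x)"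
  shows "(\<forall>x\<in>I. (G has_vector_derivative f x) (at x)) \<longleftrightarrow> (\<exists>C. \<forall>x\<in>I. G x = F x + C)"
proof
  assume G: "\<forall>x\<in>I. (G has_vector_derivative f x) (at x)"
  have "convex I"
    using assms(2) by (simp add: connected_convex_1)
  moreover have "((\<lambda>x. G x - F x) has_vector_derivative 0) (at x within I)" if "x \<in> I" for x
    using has_vector_derivative_diff[OF bspec[OF G that] F[OF that]]
    by (simp add: has_vector_derivative_at_within)
  ultimately have "\<exists>C. \<forall>x\<in>I. G x - F x = C"
    by (rule has_vector_derivative_zero_constant) auto
  then show "\<exists>C. \<forall>x\<in>I. G x = F x + C"
    by (metis diff_add_cancel add.commute)
next
  assume "\<exists>C. \<forall>x\<in>I. G x = F x + C"
  then obtain C where C: "\<forall>x\<in>I. G x = F x + C" ..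
  show "\<forall>x\<in>I. (G has_vector_derivative f x) (at x)"
  proof
    fix x assume "x \<in> I"
    show "(G has_vector_derivative f x) (at x)"
    proof (rule has_vector_derivative_transform_within_open)
      show "((\<lambda>x. F x + C) has_vector_derivative f x) (at x)"
        using F[OF \<open>x \<in> I\<close>] by (auto intro!: derivative_eq_intros)
    qed (use assms C \<open>x \<in> I\<close> in auto)
  qed
qed

lemma has_field_derivative_iff_eq_plus_const:
  fixes f :: "'a::{real_normed_field,euclidean_space} \<Rightarrow> 'a"
  assumes "open S" and "connected S"
    and F: "\<And>x. x \<in> S \<Longrightarrow> (F has_field_derivative f x) (at x)"
  shows "(\<forall>x\<in>S. (G has_field_derivative f x) (at x)) \<longleftrightarrow> (\<exists>C. \<forall>x\<in>S. G x = F x + C)"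
proof
  assume G: "\<forall>x\<in>S. (G has_field_derivative f x) (at x)"
  have "((\<lambda>x. G x - F x) has_field_derivative 0) (at x)" if "x \<in> S" for x
    using DERIV_diff[OF bspec[OF G that] F[OF that]] by simp
  then have "(\<lambda>x. G x - F x) constant_on S"
    using assms by (intro has_field_derivative_0_imp_constant_on)
  then obtain C where "\<And>x. x \<in> S \<Longrightarrow> G x - F x = C"
    by (auto simp: constant_on_def)
  then show "\<exists>C. \<forall>x\<in>S. G x = F x + C"
    by (metis diff_add_cancel add.commute)
next
  assume "\<exists>C. \<forall>x\<in>S. G x = F x + C"
  then obtain C where C: "\<forall>x\<in>S. G x = F x + C" ..
  show "\<forall>x\<in>S. (G has_field_derivative f x) (at x)"
  proof
    fix x assume "x \<in> S"
    show "(G has_field_derivative f x) (at x)"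
    proof (rule has_field_derivative_transform_within_open)
      show "((\<lambda>x. F x + C) has_field_derivative f x) (at x)"
        using F[OF \<open>x \<in> S\<close>] by (auto intro!: derivative_eq_intros)
    qed (use assms C \<open>x \<in> S\<close> in auto)
  qed
qed

section \<open>The integral formula\<close>

text \<open>The indefinite integral with its \<open>C\<close> is read as an equivalence describing
  all antiderivatives; connected domains allow a single constant. The conditions on non-positive
  integers make both 1F2 series well defined.\<close>

theorem proposition4:
  fixes \<alpha> \<beta> \<eta> :: complex and f F :: "complex \<Rightarrow> complex"
  assumes "\<eta> \<noteq> 0" and "\<beta> \<noteq> 0"
    and "\<alpha> \<noteq> -1" and "\<alpha> \<noteq> -\<beta> - 1"
    and "(\<alpha> + \<beta> + 1) / (2 * \<beta>) \<notin> \<int>\<^sub>\<le>\<^sub>0"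
    and "(\<alpha> + 2 * \<beta> + 1) / (2 * \<beta>) \<notin> \<int>\<^sub>\<le>\<^sub>0"
    and "(\<alpha> + 3 * \<beta> + 1) / (2 * \<beta>) \<notin> \<int>\<^sub>\<le>\<^sub>0"
    and f: "\<And>x. f x = x powr \<alpha> * cos (\<eta> * x powr \<beta>)"
    and F: "\<And>x. F x = x powr (\<alpha> + 1) / ((\<alpha> + 1) * (\<alpha> + \<beta> + 1)) *
       ((\<alpha> + \<beta> + 1) * cos (\<eta> * x powr \<beta>) *
          hypergeom_1F2 1 ((\<alpha> + \<beta> + 1) / (2 * \<beta>)) ((\<alpha> + 2 * \<beta> + 1) / (2 * \<beta>))
            (- (\<eta>\<^sup>2 * x powr (2 * \<beta>) / 4)) +
        \<beta> * \<eta> * x powr \<beta> * sin (\<eta> * x powr \<beta>) *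
          hypergeom_1F2 1 ((\<alpha> + 2 * \<beta> + 1) / (2 * \<beta>)) ((\<alpha> + 3 * \<beta> + 1) / (2 * \<beta>))
            (- (\<eta>\<^sup>2 * x powr (2 * \<beta>) / 4)))"
  shows
    "(\<forall>(I :: real set) (G :: real \<Rightarrow> complex). open I \<and> connected I \<and> 0 \<notin> I \<longrightarrow>
        (\<forall>x\<in>I. (G has_vector_derivative f (of_real x)) (at x)) \<longleftrightarrow>
        (\<exists>C. \<forall>x\<in>I. G x = F (of_real x) + C)) \<and>
     (\<forall>(S :: complex set) (G :: complex \<Rightarrow> complex). open S \<and> connected S \<and> S \<inter> \<real>\<^sub>\<le>\<^sub>0 = {} \<longrightarrow>
        (\<forall>z\<in>S. (G has_field_derivative f z) (at z)) \<longleftrightarrow>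
        (\<exists>C. \<forall>z\<in>S. G z = F z + C))"
proof -
  define c where "c = (\<alpha> + 1) / \<beta> + 1"
  have c2: "(\<alpha> + \<beta> + 1) / (2 * \<beta>) = c / 2" "(\<alpha> + 2 * \<beta> + 1) / (2 * \<beta>) = (c + 1) / 2"
    "(\<alpha> + 3 * \<beta> + 1) / (2 * \<beta>) = (c + 2) / 2" and c\<beta>: "\<alpha> + \<beta> + 1 = c * \<beta>"
    using \<open>\<beta> \<noteq> 0\<close> by (simp_all add: c_def field_simps)
  have "c \<notin> \<int>\<^sub>\<le>\<^sub>0"
  proof
    assume "c \<in> \<int>\<^sub>\<le>\<^sub>0"
    then obtain n where "c = - of_nat n"
      by (rule nonpos_Ints_cases')
    \<comment> \<open>The length \<open>2 * n + 2\<close> exceeds \<open>n\<close>, so the zero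
      factor \<open>c + n\<close> occurs; being even, it lets duplication move the zero to a lower
      parameter.\<close>
    then have "pochhammer c (2 * Suc n) = 0"
      by (auto simp: pochhammer_eq_0_iff)
    then have "c / 2 \<in> \<int>\<^sub>\<le>\<^sub>0 \<or> (c + 1) / 2 \<in> \<int>\<^sub>\<le>\<^sub>0"
      unfolding pochhammer_even by (auto dest: pochhammer_eq_0_imp_nonpos_Int)
    with assms(5,6) show False
      unfolding c2 by blast
  qed
  then have "c \<noteq> 0"
    by auto
  have \<alpha>: "\<alpha> + 1 \<noteq> 0"
    using \<open>\<alpha> \<noteq> - 1\<close> by (simp add: eq_neg_iff_add_eq_0)
  define P where "P = (\<lambda>w. cos w * hypergeom_1F2 1 (c / 2) ((c + 1) / 2) (- (w\<^sup>2 / 4)) +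
      sin w * (w / c * hypergeom_1F2 1 ((c + 1) / 2) ((c + 2) / 2) (- (w\<^sup>2 / 4))))"
  define H where "H = (\<lambda>t. exp ((\<alpha> + 1) * t) / (\<alpha> + 1) * P (\<eta> * exp (\<beta> * t)))"
  have H: "(H has_field_derivative exp ((\<alpha> + 1) * t) * cos (\<eta> * exp (\<beta> * t))) (at t)" for t
    unfolding H_def P_def c_def
    using \<open>\<eta> \<noteq> 0\<close> \<open>\<beta> \<noteq> 0\<close> \<open>\<alpha> \<noteq> - 1\<close> \<open>c \<notin> \<int>\<^sub>\<le>\<^sub>0\<close>[unfolded c_def]
    by (rule has_field_derivative_power_cos_antiderivative)
  have FH: "F x = H (Ln x)" if "x \<noteq> 0" for x
  proof -
    \<comment> \<open>No branch problem arises: both powers use the same \<open>Ln x\<close>, so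
      this is only doubling in the exponential.\<close>
    have sq: "\<eta>\<^sup>2 * x powr (2 * \<beta>) / 4 = (\<eta> * x powr \<beta>)\<^sup>2 / 4"
      by (simp add: power_mult_distrib powr_def that flip: exp_double mult.assoc)
    have powr: "exp ((\<alpha> + 1) * Ln x) = x powr (\<alpha> + 1)" "exp (\<beta> * Ln x) = x powr \<beta>"
      using that by (simp_all add: powr_def)
    have cancel: "X / (a * (c * \<beta>)) * (c * \<beta> * C * A + \<beta> * \<eta> * w * S * B) =
        X / a * (C * A + S * (\<eta> * w / c * B))" if "a \<noteq> 0" for X a A B C S w
      using that \<open>c \<noteq> 0\<close> \<open>\<beta> \<noteq> 0\<close> by (simp add: field_simps)
    show ?thesis
      unfolding F H_def P_def c2 sq powr unfolding c\<beta> by (rule cancel[OF \<alpha>])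
  qed
  \<comment> \<open>The chain-rule factor \<open>1 / x\<close> lowers the exponent from
    \<open>\<alpha> + 1\<close> to \<open>\<alpha>\<close>.\<close>
  have f_eq: "1 / x * (exp ((\<alpha> + 1) * Ln x) * cos (\<eta> * exp (\<beta> * Ln x))) = f x" if "x \<noteq> 0" for x
    using that by (simp add: f powr_def distrib_right exp_add)
  have F_real: "((\<lambda>x. F (of_real x)) has_vector_derivative f (of_real x)) (at x)"
    if "x \<noteq> 0" for x :: real
  proof (rule has_vector_derivative_transform_within_open)
    \<comment> \<open>\<open>H\<close> is complex differentiable everywhere, so the derivative of
      \<open>Ln\<close> along the real line suffices, even on the cut.\<close>
    show "(H \<circ> (\<lambda>x. Ln (of_real x)) has_vector_derivative f (of_real x)) (at x)"
      using field_vector_diff_chain_at[OF has_vector_derivative_Ln_of_real[OF that] H] f_eq[of "of_real x"] that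
      by simp
    show "open (- {0 :: real})"
      by (simp add: open_Compl)
  qed (use that in \<open>auto simp: FH\<close>)
  have F_complex: "(F has_field_derivative f z) (at z)" if "z \<notin> \<real>\<^sub>\<le>\<^sub>0" for z
  proof (rule has_field_derivative_transform_within_open)
    have "z \<noteq> 0"
      using that by auto
    show "((\<lambda>z. H (Ln z)) has_field_derivative f z) (at z)"
      using DERIV_chain2[OF H has_field_derivative_Ln[OF that]] f_eq[OF \<open>z \<noteq> 0\<close>]
      by (simp add: field_simps)
    show "open (- \<real>\<^sub>\<le>\<^sub>0 :: complex set)"
      by (simp add: open_Compl)
  qed (use that in \<open>auto intro!: FH[symmetric]\<close>)
  show ?thesis
  proof (intro conjI allI impI)
    fix I :: "real set" and G :: "real \<Rightarrow> complex"
    assume "open I \<and> connected I \<and> 0 \<notin> I"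
    then show "(\<forall>x\<in>I. (G has_vector_derivative f (of_real x)) (at x)) \<longleftrightarrow>
        (\<exists>C. \<forall>x\<in>I. G x = F (of_real x) + C)"
      by (intro has_vector_derivative_iff_eq_plus_const F_real) auto
  next
    fix S :: "complex set" and G :: "complex \<Rightarrow> complex"
    assume "open S \<and> connected S \<and> S \<inter> \<real>\<^sub>\<le>\<^sub>0 = {}"
    then show "(\<forall>z\<in>S. (G has_field_derivative f z) (at z)) \<longleftrightarrow> (\<exists>C. \<forall>z\<in>S. G z = F z + C)"
      by (intro has_field_derivative_iff_eq_plus_const F_complex) auto
  qed
qed

end
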